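(* For $i=1,2$ let $V_i,Q_i,\Lambda_i$ be real Hilbert spaces and let $A_i:V_i\to V_i'$, $B_i:V_i\to Q_i'$, $T_i:V_i\to\Lambda_i'$ be linear operators. Suppose that for $i=1,2$ the Brezzi conditions hold: there are positive constants $\alpha_i,C_i,\beta_i,D_i$ such that (B1) $(A_iu_i,u_i)\ge\alpha_i\|u_i\|_{V_i}^2$ for all $u_i\in Z_i$, where $Z_i=\{u_i\in V_i : (B_iu_i,q_i)+(T_iu_i,\lambda_i)=0\ \ \forall q_i\in Q_i,\ \lambda_i\in\Lambda_i\}$; (B2) $(A_iu_i,v_i)\le C_i\|u_i\|_{V_i}\|v_i\|_{V_i}$ for all $u_i,v_i\in V_i$; (B3) $\displaystyle\sup_{0\neq u_i\in V_i}\frac{(B_iu_i,q_i)+(T_iu_i,\lambda_i)}{\|u_i\|_{V_i}}\ge\beta_i\big(\|q_i\|_{Q_i}^2+\|\lambda_i\|_{\Lambda_i}^2\big)^{1/2}$ for all $q_i\in Q_i$, $\lambda_i\in\Lambda_i$; (B4) $(B_iu_i,q_i)+(T_iu_i,\lambda_i)\le D_i\|u_i\|_{V_i}\big(\|q_i\|_{Q_i}^2+\|\lambda_i\|_{\Lambda_i}^2\big)^{1/2}$ for all $u_i\in V_i$, $q_i\in Q_i$, $\lambda_i\in\Lambda_i$. Suppose moreover that the stronger coercivity condition (B1') $(A_iu_i,u_i)\ge\alpha_i\|u_i\|_{V_i}^2$ for all $u_i\in V_i$ with $(B_iu_i,q_i)=0\ \ \forall q_i\in Q_i$ holds for $i=1,2$.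 Let $W=V_1\times V_2\times Q_1\times Q_2\times(\Lambda_1\cap\Lambda_2)$ and let $\mathcal A:W\to W'$ be the operator $$\mathcal A=\begin{pmatrix} A_1 & & B_1' & & T_1' \\ & A_2 & & B_2' & T_2' \\ B_1 & & & & \\ & B_2 & & & \\ T_1 & T_2 & & & \end{pmatrix},$$ i.e. $(\mathcal A(u_1,u_2,p_1,p_2,\lambda),(v_1,v_2,q_1,q_2,w))=\sum_{i=1}^2\big[(A_iu_i,v_i)+(B_iv_i,p_i)+(T_iv_i,\lambda)+(B_iu_i,q_i)+(T_iu_i,w)\big]$. Then the coupled problem $\mathcal A x=b$ is well posed in $W$, in the sense that $\mathcal A$ is invertible and both $\|\mathcal A\|_{\mathcal L(W,W')}$ and $\|\mathcal A^{-1}\|_{\mathcal L(W',W)}$ are bounded by some positive constant $C$ depending only on the Brezzi constants $\alpha_i,\beta_i,C_i,D_i$, $i=1,2$.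
   Context: $X'$ is the dual of $X$; $(\cdot,\cdot)$ denotes the duality pairing; $B'$ is the dual (adjoint) operator of $B$; $\mathcal L(X,Y)$ is the space of bounded linear operators with the operator norm. $\Lambda_1$ and $\Lambda_2$ are assumed to be continuously embedded in a common Hausdorff topological vector space, so that the intersection $\Lambda_1\cap\Lambda_2$ makes sense and is a Hilbert space with norm $\|\lambda\|_{\Lambda_1\cap\Lambda_2}=(\|\lambda\|_{\Lambda_1}^2+\|\lambda\|_{\Lambda_2}^2)^{1/2}$; its dual is $\Lambda_1'+\Lambda_2'$. The product space $W$ carries the product Hilbert norm (square root of the sum of squares of the component norms). *)

theory Defs
  imports "HOL-Analysis.Analysis"
begin

text \<open>
  Real Hilbert spaces are types of sort \<open>{real_inner, complete_space}\<close>. The dual of \<open>'x\<close>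
  is \<open>'x \<Rightarrow>\<^sub>L real\<close>, and the pairing of \<open>f\<close> with \<open>x\<close> is \<open>blinfun_apply f x\<close>.
\<close>

definition brezzi_kernel ::
    "('v::{real_inner,complete_space} \<Rightarrow> ('q::{real_inner,complete_space} \<Rightarrow>\<^sub>L real)) \<Rightarrow>
     ('v \<Rightarrow> ('l::{real_inner,complete_space} \<Rightarrow>\<^sub>L real)) \<Rightarrow> 'v set" where
  "brezzi_kernel B T =
     {u. \<forall>q l. blinfun_apply (B u) q + blinfun_apply (T u) l = 0}"

text \<open>
  The four conjuncts after positivity are, in order, coercivity on the kernel, boundedness of
  \<open>A\<close>, the inf-sup condition, and boundedness of the constraint form. The last one bounds
  the quotients in the inf-sup condition, so their real supremum is meaningful. The inserted 0
  only matters for \<open>V = {0}\<close>, where it fixes the supremum of the empty set as 0; otherwise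
  the supremum is nonnegative anyway, as \<open>u\<close> may be replaced by \<open>- u\<close>.
\<close>

definition brezzi_conditions ::
    "('v::{real_inner,complete_space} \<Rightarrow> ('v \<Rightarrow>\<^sub>L real)) \<Rightarrow>
     ('v \<Rightarrow> ('q::{real_inner,complete_space} \<Rightarrow>\<^sub>L real)) \<Rightarrow>
     ('v \<Rightarrow> ('l::{real_inner,complete_space} \<Rightarrow>\<^sub>L real)) \<Rightarrow>
     real \<Rightarrow> real \<Rightarrow> real \<Rightarrow> real \<Rightarrow> bool" where
  "brezzi_conditions A B T \<alpha> C \<beta> D \<longleftrightarrow>
     0 < \<alpha> \<and> 0 < C \<and> 0 < \<beta> \<and> 0 < D \<and>
     (\<forall>u\<in>brezzi_kernel B T. blinfun_apply (A u) u \<ge> \<alpha> * (norm u)\<^sup>2) \<and>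
     (\<forall>u v. blinfun_apply (A u) v \<le> C * norm u * norm v) \<and>
     (\<forall>q l. Sup (insert 0 {(blinfun_apply (B u) q + blinfun_apply (T u) l) / norm u | u. u \<noteq> 0})
              \<ge> \<beta> * sqrt ((norm q)\<^sup>2 + (norm l)\<^sup>2)) \<and>
     (\<forall>u q l. blinfun_apply (B u) q + blinfun_apply (T u) l
              \<le> D * norm u * sqrt ((norm q)\<^sup>2 + (norm l)\<^sup>2))"

definition strong_coercivity ::
    "('v::{real_inner,complete_space} \<Rightarrow> ('v \<Rightarrow>\<^sub>L real)) \<Rightarrow>
     ('v \<Rightarrow> ('q::{real_inner,complete_space} \<Rightarrow>\<^sub>L real)) \<Rightarrow> real \<Rightarrow> bool" where
  "strong_coercivity A B \<alpha> \<longleftrightarrow>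
     (\<forall>u. (\<forall>q. blinfun_apply (B u) q = 0) \<longrightarrow> blinfun_apply (A u) u \<ge> \<alpha> * (norm u)\<^sup>2)"

text \<open>
  The sort makes addition continuous and the topology Hausdorff. Joint continuity of scalar
  multiplication is what is missing for a Hausdorff topological vector space.
\<close>

definition hausdorff_tvs ::
    "'e::{real_vector,topological_ab_group_add,t2_space} itself \<Rightarrow> bool" where
  "hausdorff_tvs _ \<longleftrightarrow> continuous_on UNIV (\<lambda>(c::real, x::'e). c *\<^sub>R x)"

definition continuous_embedding ::
    "('l::{real_inner,complete_space} \<Rightarrow> 'e::{real_vector,topological_ab_group_add,t2_space}) \<Rightarrow> bool" where
  "continuous_embedding j \<longleftrightarrow> linear j \<and> inj j \<and> continuous_on UNIV j"

text \<open>
  \<open>is_intersection j1 j2 j\<close>: the Hilbert space \<open>'l\<close>, identified through \<open>j\<close> with a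
  subspace of \<open>'e\<close>, is the intersection of \<open>'l1\<close> and \<open>'l2\<close>, with the intersection norm.
  The element of \<open>'l1\<close> that is the same vector as \<open>x :: 'l\<close> is \<open>inv j1 (j x)\<close>.
\<close>

definition is_intersection ::
    "('l1::{real_inner,complete_space} \<Rightarrow> 'e::{real_vector,topological_ab_group_add,t2_space}) \<Rightarrow>
     ('l2::{real_inner,complete_space} \<Rightarrow> 'e) \<Rightarrow>
     ('l::{real_inner,complete_space} \<Rightarrow> 'e) \<Rightarrow> bool" where
  "is_intersection j1 j2 j \<longleftrightarrow>
     linear j \<and> inj j \<and> range j = range j1 \<inter> range j2 \<and>
     (\<forall>x. norm x = sqrt ((norm (inv j1 (j x)))\<^sup>2 + (norm (inv j2 (j x)))\<^sup>2))"

text \<open>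
  In the next two definitions, \<open>i1\<close> and \<open>i2\<close> are the inclusions of the intersection into
  the two multiplier spaces. The norm of the iterated product type is the square root of the
  sum of the squares of the component norms.
\<close>

definition coupled_form ::
    "('v1::{real_inner,complete_space} \<Rightarrow> ('v1 \<Rightarrow>\<^sub>L real)) \<Rightarrow>
     ('v2::{real_inner,complete_space} \<Rightarrow> ('v2 \<Rightarrow>\<^sub>L real)) \<Rightarrow>
     ('v1 \<Rightarrow> ('q1::{real_inner,complete_space} \<Rightarrow>\<^sub>L real)) \<Rightarrow>
     ('v2 \<Rightarrow> ('q2::{real_inner,complete_space} \<Rightarrow>\<^sub>L real)) \<Rightarrow>
     ('v1 \<Rightarrow> ('l1::{real_inner,complete_space} \<Rightarrow>\<^sub>L real)) \<Rightarrow>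
     ('v2 \<Rightarrow> ('l2::{real_inner,complete_space} \<Rightarrow>\<^sub>L real)) \<Rightarrow>
     ('l::{real_inner,complete_space} \<Rightarrow> 'l1) \<Rightarrow> ('l \<Rightarrow> 'l2) \<Rightarrow>
     'v1 \<times> 'v2 \<times> 'q1 \<times> 'q2 \<times> 'l \<Rightarrow> 'v1 \<times> 'v2 \<times> 'q1 \<times> 'q2 \<times> 'l \<Rightarrow> real" where
  "coupled_form A1 A2 B1 B2 T1 T2 i1 i2 = (\<lambda>(u1, u2, p1, p2, l) (v1, v2, q1, q2, w).
       (blinfun_apply (A1 u1) v1 + blinfun_apply (B1 v1) p1 + blinfun_apply (T1 v1) (i1 l)
          + blinfun_apply (B1 u1) q1 + blinfun_apply (T1 u1) (i1 w))
     + (blinfun_apply (A2 u2) v2 + blinfun_apply (B2 v2) p2 + blinfun_apply (T2 v2) (i2 l)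
          + blinfun_apply (B2 u2) q2 + blinfun_apply (T2 u2) (i2 w)))"

text \<open>
  \<open>Blinfun\<close> returns the intended functional only if the form is bounded and linear in its
  second argument, so the main result also asserts that the operator represents the form.
\<close>

definition coupled_operator ::
    "('v1::{real_inner,complete_space} \<Rightarrow> ('v1 \<Rightarrow>\<^sub>L real)) \<Rightarrow>
     ('v2::{real_inner,complete_space} \<Rightarrow> ('v2 \<Rightarrow>\<^sub>L real)) \<Rightarrow>
     ('v1 \<Rightarrow> ('q1::{real_inner,complete_space} \<Rightarrow>\<^sub>L real)) \<Rightarrow>
     ('v2 \<Rightarrow> ('q2::{real_inner,complete_space} \<Rightarrow>\<^sub>L real)) \<Rightarrow>
     ('v1 \<Rightarrow> ('l1::{real_inner,complete_space} \<Rightarrow>\<^sub>L real)) \<Rightarrow>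
     ('v2 \<Rightarrow> ('l2::{real_inner,complete_space} \<Rightarrow>\<^sub>L real)) \<Rightarrow>
     ('l::{real_inner,complete_space} \<Rightarrow> 'l1) \<Rightarrow> ('l \<Rightarrow> 'l2) \<Rightarrow>
     'v1 \<times> 'v2 \<times> 'q1 \<times> 'q2 \<times> 'l \<Rightarrow> (('v1 \<times> 'v2 \<times> 'q1 \<times> 'q2 \<times> 'l) \<Rightarrow>\<^sub>L real)" where
  "coupled_operator A1 A2 B1 B2 T1 T2 i1 i2 x = Blinfun (coupled_form A1 A2 B1 B2 T1 T2 i1 i2 x)"

text \<open>
  Within HOL, an existential constant cannot be placed in front of a quantification over the
  spaces, which are types, so it could depend on them. A fixed function of the eight Brezzi
  constants, whose type mentions none of the spaces, expresses the dependence on those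
  constants only. The summand \<open>c + d\<close> bounds the operator; the others are the coefficients
  in Brezzi's estimates
  \<open>\<parallel>u\<parallel> \<le> \<parallel>f\<parallel> / \<alpha> + (1 + c / \<alpha>) / \<beta> * \<parallel>g\<parallel>\<close> and
  \<open>\<parallel>p\<parallel> \<le> (1 + c / \<alpha>) / \<beta> * \<parallel>f\<parallel> + c / \<beta>\<^sup>2 * (1 + c / \<alpha>) * \<parallel>g\<parallel>\<close>
  for the coupled saddle point problem.
\<close>

definition coupled_bound ::
    "real \<Rightarrow> real \<Rightarrow> real \<Rightarrow> real \<Rightarrow> real \<Rightarrow> real \<Rightarrow> real \<Rightarrow> real \<Rightarrow> real" where
  "coupled_bound \<alpha>1 C1 \<beta>1 D1 \<alpha>2 C2 \<beta>2 D2 =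
     (let \<alpha> = min \<alpha>1 \<alpha>2; c = max C1 C2; \<beta> = min \<beta>1 \<beta>2; d = max D1 D2
      in c + d + 1 / \<alpha> + 2 / \<beta> * (1 + c / \<alpha>) + c / \<beta>\<^sup>2 * (1 + c / \<alpha>))"

end

theory Submission
  imports Defs
begin

text \<open>
  The coupled problem is one saddle point problem on \<open>V1 \<times> V2\<close> with multipliers in
  \<open>Q1 \<times> Q2 \<times> L\<close>, \<open>L\<close> being the intersection. The multiplier norm is the Pythagorean sum of the
  norms of \<open>(q1, i1 l)\<close> and \<open>(q2, i2 l)\<close>, so the two inf-sup conditions add up to the coupled one
  with constant \<open>min \<beta>1 \<beta>2\<close>. The coupled kernel only constrains the sum of the two multiplier
  terms, which is why coercivity is needed on the larger kernels of \<open>B1\<close> and \<open>B2\<close>. Brezzi's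
  estimates then bound the coupled operator from below; no nonzero vector annihilates its range,
  so by the Banach-Necas-Babuska theorem it is invertible.

  Throughout, functionals are represented by vectors: the constraint form is \<open>inner (R p) v\<close>
  and its inf-sup condition says that \<open>R\<close> is bounded below.
\<close>

section \<open>Orthogonal projection and Riesz representation in Hilbert spaces\<close>

text \<open>A minimizing sequence for the distance from \<open>x\<close> to \<open>M\<close> is
  Cauchy by the parallelogram law. Its limit is a nearest point, and a nearest point cannot be
  improved by moving inside \<open>M\<close>, which is orthogonality.\<close>

lemma closed_subspace_orthogonal_decomposition:
  fixes x :: "'a::{real_inner,complete_space}"
  assumes sub: "subspace M" and cl: "closed M"
  obtains m where "m \<in> M" "\<And>y. y \<in> M \<Longrightarrow> inner (x - m) y = 0"
proof -
  define d where "d = infdist x M"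
  have ne: "M \<noteq> {}" using subspace_0[OF sub] by auto
  have d0: "0 \<le> d" unfolding d_def by (rule infdist_nonneg)
  have dle: "d \<le> norm (x - y)" if "y \<in> M" for y
    unfolding d_def dist_norm[symmetric] by (rule infdist_le[OF that])
  have dle2: "d\<^sup>2 \<le> (norm (x - y))\<^sup>2" if "y \<in> M" for y
    using power_mono[OF dle[OF that] d0] .
  \<comment> \<open>The slack is put on the squared distance, so that the terms in
    \<open>d\<^sup>2\<close> cancel in the parallelogram law below.\<close>
  have ex: "\<exists>m\<in>M. (norm (x - m))\<^sup>2 < d\<^sup>2 + 1 / real (Suc k)" for k
  proof -
    have "d < sqrt (d\<^sup>2 + 1 / real (Suc k))"
      using d0 by (intro real_less_rsqrt) simp
    moreover have "(INF a\<in>M. dist x a) = d" unfolding d_def using infdist_notempty[OF ne] by simp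
    ultimately have "(INF a\<in>M. dist x a) < sqrt (d\<^sup>2 + 1 / real (Suc k))" by simp
    then obtain m where m: "m \<in> M" "dist x m < sqrt (d\<^sup>2 + 1 / real (Suc k))"
      using ne by (auto simp: cINF_less_iff)
    have "(norm (x - m))\<^sup>2 < (sqrt (d\<^sup>2 + 1 / real (Suc k)))\<^sup>2"
      using m(2) by (intro power_strict_mono) (auto simp: dist_norm)
    then show ?thesis using m(1) by (auto simp: add_nonneg_nonneg)
  qed
  obtain m where mM: "\<And>k. m k \<in> M"
    and mb: "\<And>k. (norm (x - m k))\<^sup>2 < d\<^sup>2 + 1 / real (Suc k)"
    using ex by metis
  have diff: "(norm (m k - m l))\<^sup>2 \<le> 2 / real (Suc k) + 2 / real (Suc l)" for k l
  proof -
    have mid: "(1/2) *\<^sub>R (m k + m l) \<in> M"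
      using mM sub by (intro subspace_scale subspace_add)
    \<comment> \<open>Parallelogram law for \<open>x - m k\<close> and \<open>x - m l\<close>. The
      midpoint lies in \<open>M\<close>, so its distance to \<open>x\<close> is at least
      \<open>d\<close>.\<close>
    have "(norm (m k - m l))\<^sup>2 = 2 * (norm (x - m k))\<^sup>2 + 2 * (norm (x - m l))\<^sup>2
            - 4 * (norm (x - (1/2) *\<^sub>R (m k + m l)))\<^sup>2"
      unfolding power2_norm_eq_inner by (simp add: inner_simps inner_commute algebra_simps)
    also have "\<dots> \<le> 2 * (d\<^sup>2 + 1 / real (Suc k)) + 2 * (d\<^sup>2 + 1 / real (Suc l)) - 4 * d\<^sup>2"
      using less_imp_le[OF mb[of k]] less_imp_le[OF mb[of l]] dle2[OF mid]
      by (intro diff_mono add_mono mult_left_mono) simp_all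
    finally show ?thesis by simp
  qed
  have "Cauchy m"
  proof (rule metric_CauchyI)
    fix e :: real assume e: "0 < e"
    obtain N where N: "4 / e\<^sup>2 < real N" using reals_Archimedean2 by blast
    then have N0: "0 < real N" using e by (smt (verit) divide_pos_pos zero_less_power)
    show "\<exists>N. \<forall>k\<ge>N. \<forall>l\<ge>N. dist (m k) (m l) < e"
    proof (intro exI allI impI)
      fix k l assume kl: "N \<le> k" "N \<le> l"
      have "2 / real (Suc k) \<le> 2 / real N" "2 / real (Suc l) \<le> 2 / real N"
        using kl N0 by (auto intro!: divide_left_mono)
      then have "(norm (m k - m l))\<^sup>2 \<le> 4 / real N" using diff[of k l] by linarith
      also have "\<dots> < e\<^sup>2" using N N0 e by (simp add: field_simps)
      finally show "dist (m k) (m l) < e"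
        using e by (simp add: dist_norm power2_less_imp_less)
    qed
  qed
  then obtain p where p: "m \<longlonglongrightarrow> p" using Cauchy_convergent convergent_def by blast
  have pM: "p \<in> M" using closed_sequentially[OF cl] mM p by blast
  have "(\<lambda>k. (norm (x - m k))\<^sup>2) \<longlonglongrightarrow> (norm (x - p))\<^sup>2"
    by (intro tendsto_intros p)
  moreover have "(\<lambda>k. d\<^sup>2 + 1 / real (Suc k)) \<longlonglongrightarrow> d\<^sup>2 + 0"
    by (intro tendsto_intros LIMSEQ_Suc lim_1_over_n)
  ultimately have pd: "(norm (x - p))\<^sup>2 \<le> d\<^sup>2"
    using mb by (intro LIMSEQ_le) (auto intro: less_imp_le simp del: of_nat_Suc)
  show ?thesis
  proof (rule that[OF pM])
    fix y assume y: "y \<in> M"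
    show "inner (x - p) y = 0"
    proof (cases "y = 0")
      case False
      \<comment> \<open>This \<open>t\<close> minimizes the distance from \<open>x - p\<close> to
        the line through \<open>y\<close>. The decrease it would produce has to vanish.\<close>
      define t where "t = inner (x - p) y / inner y y"
      have yy: "0 < inner y y" using False by simp
      have "p + t *\<^sub>R y \<in> M" using pM y sub by (intro subspace_add subspace_scale)
      then have "d\<^sup>2 \<le> (norm (x - (p + t *\<^sub>R y)))\<^sup>2" by (rule dle2)
      also have "\<dots> = (norm (x - p))\<^sup>2 - 2 * t * inner (x - p) y + t\<^sup>2 * inner y y"
        unfolding power2_norm_eq_inner
        by (simp add: inner_simps inner_commute algebra_simps power2_eq_square)
      also have "\<dots> = (norm (x - p))\<^sup>2 - (inner (x - p) y)\<^sup>2 / inner y y"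
        using yy by (simp add: t_def field_simps power2_eq_square)
      finally have "(inner (x - p) y)\<^sup>2 / inner y y \<le> 0" using pd by linarith
      then show ?thesis using yy by (simp add: divide_le_0_iff)
    qed simp
  qed
qed

text \<open>The kernel of a nonzero \<open>f\<close> is a closed hyperplane. A vector orthogonal to
  it represents \<open>f\<close> after scaling.\<close>

lemma riesz_representation:
  fixes f :: "'a::{real_inner,complete_space} \<Rightarrow>\<^sub>L real"
  shows "\<exists>z. \<forall>x. inner z x = blinfun_apply f x"
proof (cases "f = 0")
  case True
  then show ?thesis by (intro exI[of _ 0]) simp
next
  case False
  then obtain x where x: "blinfun_apply f x \<noteq> 0" by (metis blinfun_eqI zero_blinfun.rep_eq)
  define M where "M = {y. blinfun_apply f y = 0}"
  have "subspace M" unfolding M_def subspace_def by (auto simp: blinfun.bilinear_simps)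
  moreover have "closed M" unfolding M_def by (intro closed_Collect_eq continuous_intros)
  ultimately obtain m where m: "m \<in> M" "\<And>y. y \<in> M \<Longrightarrow> inner (x - m) y = 0"
    using closed_subspace_orthogonal_decomposition by metis
  define z where "z = x - m"
  have fz: "blinfun_apply f z = blinfun_apply f x"
    using m(1) by (simp add: z_def M_def blinfun.bilinear_simps)
  have zz: "inner z z \<noteq> 0" using fz x by auto
  show ?thesis
  proof (intro exI[of _ "(blinfun_apply f z / inner z z) *\<^sub>R z"] allI)
    fix y
    \<comment> \<open>Removing the right multiple of \<open>z\<close> moves \<open>y\<close> into
      the kernel, so \<open>inner z y\<close> is proportional to the value of \<open>f\<close> at
      \<open>y\<close>.\<close>
    have "y - (blinfun_apply f y / blinfun_apply f z) *\<^sub>R z \<in> M"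
      using fz x by (simp add: M_def blinfun.bilinear_simps)
    then have "inner z (y - (blinfun_apply f y / blinfun_apply f z) *\<^sub>R z) = 0"
      using m(2) by (simp add: z_def)
    then show "inner ((blinfun_apply f z / inner z z) *\<^sub>R z) y = blinfun_apply f y"
      using zz fz x by (simp add: inner_simps field_simps)
  qed
qed

text \<open>The representing vector is unique, so the choice is harmless. The map turns an operator
  into the dual into an operator into the space itself, where orthogonality to the range can be
  used.\<close>

definition riesz :: "('a::{real_inner,complete_space} \<Rightarrow>\<^sub>L real) \<Rightarrow> 'a" where
  "riesz f = (SOME z. \<forall>x. inner z x = blinfun_apply f x)"

lemma inner_riesz [simp]: "inner (riesz f) x = blinfun_apply f x"
  using someI_ex[OF riesz_representation, of f] unfolding riesz_def by blast

lemma riesz_unique: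
  assumes "\<And>x. inner z x = blinfun_apply f x"
  shows "riesz f = z"
proof -
  have "inner (riesz f - z) (riesz f - z) = 0" by (simp add: inner_diff_left assms)
  then show ?thesis by simp
qed

lemma linear_riesz: "linear riesz"
  by (rule linearI; rule riesz_unique) (simp_all add: inner_simps blinfun.bilinear_simps)

text \<open>Test with \<open>x = z\<close> and cancel one factor \<open>norm z\<close>. This turns
  one-sided bounds on forms into norm bounds.\<close>

lemma norm_le_if_inner_le:
  assumes "\<And>x. inner z x \<le> b * norm x" and "0 \<le> b"
  shows "norm z \<le> b"
proof (cases "z = 0")
  case False
  have "norm z * norm z \<le> b * norm z"
    using assms(1)[of z] by (simp add: dot_square_norm power2_eq_square)
  then show ?thesis using False by simp
qed (simp add: assms)

lemma norm_riesz [simp]: "norm (riesz f) = norm f"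
proof (rule antisym)
  show "norm (riesz f) \<le> norm f"
    by (rule norm_le_if_inner_le) (use norm_blinfun[of f] in \<open>auto simp: abs_le_iff\<close>)
  show "norm f \<le> norm (riesz f)"
    by (rule norm_blinfun_bound) (simp_all flip: inner_riesz add: Cauchy_Schwarz_ineq2)
qed

section \<open>Operators bounded below and the Banach-Necas-Babuska theorem\<close>

lemma closed_range_if_bounded_below:
  fixes L :: "'a::{real_inner,complete_space} \<Rightarrow> 'b::{real_inner,complete_space}"
  assumes L: "bounded_linear L" and "0 < e" and "\<And>x. e * norm x \<le> norm (L x)"
  shows "closed (range L)"
  by (rule complete_imp_closed, rule complete_isometric_image[OF \<open>0 < e\<close> subspace_UNIV L])
    (use assms in \<open>auto intro: complete_UNIV\<close>)

text \<open>The lower bound gives injectivity, a closed range and the norm of the inverse. The part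
  of a vector orthogonal to the closed range is annihilated by every \<open>A x\<close>, hence is
  zero, so the range is everything.\<close>

lemma bounded_below_operator_invertible:
  fixes A :: "'a::{real_inner,complete_space} \<Rightarrow> ('a \<Rightarrow>\<^sub>L real)"
  assumes A: "bounded_linear A"
    and K: "0 < K" "\<And>x. norm x \<le> K * norm (A x)"
    and nondeg: "\<And>y. (\<And>x. blinfun_apply (A x) y = 0) \<Longrightarrow> y = 0"
  shows "bij A \<and> bounded_linear (inv A) \<and> onorm (inv A) \<le> K"
proof -
  interpret A: bounded_linear A by fact
  define L where "L x = riesz (A x)" for x
  have "linear L" unfolding L_def
    using linear_compose[OF A.linear_axioms linear_riesz] by (simp add: o_def)
  moreover have "\<exists>b. \<forall>x. norm (L x) \<le> norm x * b" using A.bounded by (simp add: L_def)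
  ultimately have L: "bounded_linear L"
    by (simp add: bounded_linear_def bounded_linear_axioms_def)
  have "closed (range L)"
    by (rule closed_range_if_bounded_below[OF L, of "1 / K"])
      (use K in \<open>auto simp: L_def field_simps\<close>)
  moreover have "subspace (range L)"
    using linear_subspace_image[OF \<open>linear L\<close> subspace_UNIV] .
  ultimately have surjL: "z \<in> range L" for z
  proof -
    obtain m where m: "m \<in> range L" "\<And>y. y \<in> range L \<Longrightarrow> inner (z - m) y = 0"
      using closed_subspace_orthogonal_decomposition[OF \<open>subspace (range L)\<close> \<open>closed (range L)\<close>]
      by metis
    have "blinfun_apply (A x) (z - m) = 0" for x
      using m(2)[of "L x"] by (simp add: L_def inner_commute[of "z - m"])
    then have "z - m = 0" by (rule nondeg)
    then show ?thesis using m(1) by simp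
  qed
  have "inj A"
    unfolding linear_injective_0[OF A.linear_axioms]
    using K(2) by (metis mult_zero_right norm_le_zero_iff norm_zero)
  moreover have "surj A"
  proof (rule surjI)
    fix f
    obtain x where "riesz f = L x" using surjL[of "riesz f"] by auto
    then have "f = A x" unfolding L_def by (metis blinfun_eqI inner_riesz)
    then show "A (inv A f) = f" by (metis f_inv_into_f rangeI)
  qed
  ultimately have "bij A" by (rule bijI)
  have AA: "A (inv A f) = f" for f using \<open>surj A\<close> by (rule surj_f_inv_f)
  have bnd: "norm (inv A f) \<le> K * norm f" for f using K(2)[of "inv A f"] by (simp add: AA)
  \<comment> \<open>By injectivity, both linearity laws may be checked after applying
    \<open>A\<close>.\<close>
  have "linear (inv A)"
  proof (rule linearI; rule injD[OF \<open>inj A\<close>])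
  qed (simp_all add: AA A.add A.scaleR)
  then have "bounded_linear (inv A)"
    using bnd by (intro bounded_linear_intro[where K = K])
      (auto simp: linear_add linear_scale mult.commute)
  moreover have "onorm (inv A) \<le> K" by (rule onorm_bound) (use K bnd in auto)
  ultimately show ?thesis using \<open>bij A\<close> by blast
qed

section \<open>Brezzi's theory of a single saddle point problem\<close>

text \<open>Split \<open>u = w + m\<close> with \<open>m\<close> in the range of \<open>R\<close>
  and \<open>w\<close> orthogonal to it, that is, in the constraint kernel. The inf-sup condition
  and \<open>g\<close> control \<open>m\<close>, coercivity controls \<open>w\<close>, and the
  inf-sup condition applied to \<open>R p = (A u + R p) - A u\<close> controls
  \<open>p\<close>.\<close>

lemma saddle_point_estimate:
  fixes A :: "'v::{real_inner,complete_space} \<Rightarrow> 'v"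
    and R :: "'q::{real_inner,complete_space} \<Rightarrow> 'v"
  assumes A: "linear A" and R: "bounded_linear R"
    and pos: "0 < \<alpha>" "0 < \<beta>" "0 \<le> c" "0 \<le> f" "0 \<le> g"
    and bound: "\<And>u. norm (A u) \<le> c * norm u"
    and infsup: "\<And>q. \<beta> * norm q \<le> norm (R q)"
    and coercive: "\<And>u. (\<And>q. inner (R q) u = 0) \<Longrightarrow> \<alpha> * (norm u)\<^sup>2 \<le> inner (A u) u"
    and F: "norm (A u + R p) \<le> f"
    and G: "\<And>q. inner (R q) u \<le> g * norm q"
  shows "norm u \<le> f / \<alpha> + (1 + c / \<alpha>) / \<beta> * g"
    and "norm p \<le> (1 + c / \<alpha>) / \<beta> * f + c / \<beta>\<^sup>2 * (1 + c / \<alpha>) * g"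
proof -
  have "subspace (range R)" "closed (range R)"
    using linear_subspace_image[OF bounded_linear.linear[OF R] subspace_UNIV]
      closed_range_if_bounded_below[OF R pos(2) infsup] by auto
  then obtain m where m: "m \<in> range R" "\<And>y. y \<in> range R \<Longrightarrow> inner (u - m) y = 0"
    using closed_subspace_orthogonal_decomposition by metis
  then obtain r where r: "m = R r" by auto
  define w where "w = u - m"
  have w: "inner (R q) w = 0" "inner w (R q) = 0" for q
    using m(2)[of "R q"] by (auto simp: w_def inner_commute)
  have u: "u = w + m" by (simp add: w_def)
  \<comment> \<open>Since \<open>m = R r\<close> and \<open>w\<close> is orthogonal to the range,
    \<open>u\<close> may replace \<open>m\<close> in one factor, and the constraint bound applies
    with \<open>q = r\<close>.\<close>
  have "norm m * norm m = inner (R r) u"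
    by (simp add: u r inner_add_right w dot_square_norm power2_eq_square)
  also have "\<dots> \<le> g * norm r" by (rule G)
  also have "\<dots> \<le> g * (norm m / \<beta>)"
    using infsup[of r] pos by (intro mult_left_mono) (auto simp: r field_simps)
  finally have "norm m * norm m \<le> (g / \<beta>) * norm m" by simp
  then have m_le: "norm m \<le> g / \<beta>"
    using mult_right_le_imp_le[of "norm m" "norm m" "g / \<beta>"] pos by (cases "m = 0") auto
  have "\<alpha> * (norm w)\<^sup>2 \<le> inner (A w) w" by (rule coercive) (rule w)
  also have "A w = A u - A m" by (simp add: w_def linear_diff[OF A])
  \<comment> \<open>Testing with the kernel vector \<open>w\<close> lets \<open>R p\<close> be added
    for free, so the residual bound \<open>f\<close> becomes available.\<close>
  also have "inner (A u - A m) w = inner (A u + R p) w - inner (A m) w"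
    by (simp add: inner_simps w)
  also have "\<dots> \<le> norm (A u + R p) * norm w + norm (A m) * norm w"
    using norm_cauchy_schwarz[of "A u + R p" w] Cauchy_Schwarz_ineq2[of "A m" w] by linarith
  also have "\<dots> \<le> f * norm w + (c * (g / \<beta>)) * norm w"
    using F order_trans[OF bound[of m] mult_left_mono[OF m_le pos(3)]]
    by (intro add_mono mult_right_mono) auto
  finally have "(\<alpha> * norm w) * norm w \<le> (f + c * (g / \<beta>)) * norm w"
    by (simp add: power2_eq_square algebra_simps)
  then have "\<alpha> * norm w \<le> f + c * (g / \<beta>)"
    using mult_right_le_imp_le[of "\<alpha> * norm w" "norm w" "f + c * (g / \<beta>)"] pos
    by (cases "w = 0") auto
  then have "norm w \<le> (f + c * (g / \<beta>)) / \<alpha>" using pos by (simp add: field_simps)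
  then have "norm u \<le> (f + c * (g / \<beta>)) / \<alpha> + g / \<beta>"
    using norm_triangle_ineq[of w m] m_le by (simp add: u)
  also have "\<dots> = f / \<alpha> + (1 + c / \<alpha>) / \<beta> * g" using pos by (simp add: field_simps)
  finally show un: "norm u \<le> f / \<alpha> + (1 + c / \<alpha>) / \<beta> * g" .
  have "\<beta> * norm p \<le> norm (R p)" by (rule infsup)
  also have "\<dots> \<le> norm (A u + R p) + norm (A u)"
    using norm_triangle_ineq4[of "A u + R p" "A u"] by simp
  also have "\<dots> \<le> f + c * (f / \<alpha> + (1 + c / \<alpha>) / \<beta> * g)"
    using F bound[of u] mult_left_mono[OF un pos(3)] by linarith
  finally have "norm p \<le> (f + c * (f / \<alpha> + (1 + c / \<alpha>) / \<beta> * g)) / \<beta>"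
    using pos by (simp add: field_simps)
  also have "\<dots> = (1 + c / \<alpha>) / \<beta> * f + c / \<beta>\<^sup>2 * (1 + c / \<alpha>) * g"
    using pos by (simp add: field_simps power2_eq_square)
  finally show "norm p \<le> (1 + c / \<alpha>) / \<beta> * f + c / \<beta>\<^sup>2 * (1 + c / \<alpha>) * g" .
qed

lemma power2_norm_Pair: "(norm (a, b))\<^sup>2 = (norm a)\<^sup>2 + (norm b)\<^sup>2"
  by (simp add: norm_Pair)

text \<open>
  The maps \<open>U\<close> and \<open>P\<close> split the space isometrically into a product, which spares
  reassociating the nested product type of the coupled problem.
\<close>

lemma saddle_point_well_posed:
  fixes A :: "'v::{real_inner,complete_space} \<Rightarrow> 'v"
    and R :: "'q::{real_inner,complete_space} \<Rightarrow> 'v"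
    and U :: "'w::{real_inner,complete_space} \<Rightarrow> 'v" and P :: "'w \<Rightarrow> 'q"
  assumes A: "linear A" and R: "linear R" and U: "linear U" and P: "linear P"
    and split: "\<And>v q. \<exists>x. U x = v \<and> P x = q"
    and norm_split: "\<And>x. (norm x)\<^sup>2 = (norm (U x))\<^sup>2 + (norm (P x))\<^sup>2"
    and pos: "0 < \<alpha>" "0 < \<beta>" "0 < c" "0 < d"
    and A_bound: "\<And>u. norm (A u) \<le> c * norm u"
    and R_bound: "\<And>q. norm (R q) \<le> d * norm q"
    and infsup: "\<And>q. \<beta> * norm q \<le> norm (R q)"
    and coercive: "\<And>u. (\<And>q. inner (R q) u = 0) \<Longrightarrow> \<alpha> * (norm u)\<^sup>2 \<le> inner (A u) u"
    and form: "\<And>x y. F x y = inner (A (U x) + R (P x)) (U y) + inner (R (P y)) (U x)"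
    and K: "K = c + d + 1 / \<alpha> + 2 / \<beta> * (1 + c / \<alpha>) + c / \<beta>\<^sup>2 * (1 + c / \<alpha>)"
  shows "(\<forall>x y. blinfun_apply (Blinfun (F x)) y = F x y)
       \<and> bij (\<lambda>x. Blinfun (F x)) \<and> 0 < K
       \<and> bounded_linear (\<lambda>x. Blinfun (F x)) \<and> onorm (\<lambda>x. Blinfun (F x)) \<le> K
       \<and> bounded_linear (inv (\<lambda>x. Blinfun (F x))) \<and> onorm (inv (\<lambda>x. Blinfun (F x))) \<le> K"
proof -
  define L where "L x = Blinfun (F x)" for x
  have Rb: "bounded_linear R"
    using R_bound by (intro bounded_linear_intro[where K = d])
      (auto simp: linear_add[OF R] linear_scale[OF R] mult.commute)
  \<comment> \<open>The factor shared by the last terms of \<open>K\<close>. Its positivity shows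
    that \<open>K\<close> exceeds \<open>c + d\<close>.\<close>
  define \<kappa> where "\<kappa> = 1 + c / \<alpha>"
  have "0 < \<kappa>" using pos by (simp add: \<kappa>_def add_pos_pos)
  then have "0 < 1 / \<alpha> + 2 / \<beta> * \<kappa> + c / \<beta>\<^sup>2 * \<kappa>"
    using pos by (simp add: add_pos_pos)
  then have cdK: "c + d \<le> K" unfolding K \<kappa>_def by simp
  then have K0: "0 < K" using pos by linarith
  have Ule: "norm (U x) \<le> norm x" for x
    using norm_split[of x] by (auto intro: power2_le_imp_le[of "norm (U x)" "norm x"])
  have bound: "\<bar>F x y\<bar> \<le> (c + d) * norm x * norm y" for x y
  proof -
    have norms: "norm (norm (P z), norm (U z)) = norm z" "norm (norm (U z), norm (P z)) = norm z" for z
      by (auto simp: norm_Pair norm_split intro!: real_sqrt_unique)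
    have "\<bar>F x y\<bar> \<le> \<bar>inner (A (U x)) (U y)\<bar> + \<bar>inner (R (P x)) (U y)\<bar> + \<bar>inner (R (P y)) (U x)\<bar>"
      unfolding form inner_add_left by linarith
    also have "\<dots> \<le> norm (A (U x)) * norm (U y) + norm (R (P x)) * norm (U y)
        + norm (R (P y)) * norm (U x)"
      by (intro add_mono Cauchy_Schwarz_ineq2)
    also have "\<dots> \<le> (c * norm (U x)) * norm (U y) + (d * norm (P x)) * norm (U y)
        + (d * norm (P y)) * norm (U x)"
      by (intro add_mono mult_right_mono A_bound R_bound norm_ge_zero)
    \<comment> \<open>The two constraint terms form an inner product of plane vectors of lengths
      \<open>norm x\<close> and \<open>norm y\<close>. Cauchy-Schwarz then gives the factor
      \<open>d\<close> instead of \<open>2 * d\<close>.\<close>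
    also have "\<dots> = c * (norm (U x) * norm (U y))
        + d * inner (norm (P x), norm (U x)) (norm (U y), norm (P y))"
      by (simp add: algebra_simps)
    also have "\<dots> \<le> c * (norm x * norm y) + d * (norm x * norm y)"
      using norm_cauchy_schwarz[of "(norm (P x), norm (U x))" "(norm (U y), norm (P y))"] pos
      unfolding norms by (intro add_mono mult_left_mono mult_mono Ule) auto
    finally show ?thesis by (simp add: algebra_simps)
  qed
  \<comment> \<open>This is what makes \<open>Blinfun (F x)\<close> the functional given by the
    form.\<close>
  have "bounded_linear (F x)" for x
    using bound[of x]
    by (intro bounded_linear_intro[where K = "(c + d) * norm x"])
      (auto simp: form linear_add[OF U] linear_scale[OF U] linear_add[OF P] linear_scale[OF P]
        linear_add[OF R] linear_scale[OF R] inner_simps algebra_simps)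
  then have LF: "blinfun_apply (L x) y = F x y" for x y
    by (simp add: L_def bounded_linear_Blinfun_apply)
  have L_add: "L (x + y) = L x + L y" and L_scale: "L (r *\<^sub>R x) = r *\<^sub>R L x" for x y r
    by (auto intro!: blinfun_eqI simp: LF blinfun.bilinear_simps form linear_add[OF U]
        linear_scale[OF U] linear_add[OF P] linear_scale[OF P] linear_add[OF A] linear_scale[OF A]
        linear_add[OF R] linear_scale[OF R] inner_simps algebra_simps)
  have L_bound: "norm (L x) \<le> (c + d) * norm x" for x
    using bound[of x] pos by (intro norm_blinfun_bound) (auto simp: LF)
  have L: "bounded_linear L"
    using L_bound by (intro bounded_linear_intro[where K = "c + d"] L_add L_scale)
      (simp add: mult.commute)
  have "onorm L \<le> c + d" using pos by (intro onorm_bound L_bound) auto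
  then have "onorm L \<le> K" using cdK by linarith
  have below: "norm x \<le> K * norm (L x)" for x
  proof -
    let ?n = "norm (L x)"
    have F_le: "F x y \<le> ?n * norm y" for y
      using norm_blinfun[of "L x" y] by (simp add: LF)
    have f: "norm (A (U x) + R (P x)) \<le> ?n"
    proof (rule norm_le_if_inner_le)
      fix v
      \<comment> \<open>Test vectors without multiplier part isolate the first equation of the
        system; below, those with only a multiplier part isolate the constraint equation.\<close>
      obtain y where y: "U y = v" "P y = 0" using split by blast
      then have "norm y = norm v" using norm_split[of y] by simp
      then show "inner (A (U x) + R (P x)) v \<le> ?n * norm v"
        using F_le[of y] y by (simp add: form linear_0[OF R])
    qed simp
    have g: "inner (R q) (U x) \<le> ?n * norm q" for q
    proof -
      obtain y where y: "U y = 0" "P y = q" using split by blast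
      then have "norm y = norm q" using norm_split[of y] by simp
      then show ?thesis using F_le[of y] y by (simp add: form)
    qed
    have "(norm x)\<^sup>2 \<le> (norm (U x) + norm (P x))\<^sup>2"
      by (simp add: norm_split power2_sum)
    then have "norm x \<le> norm (U x) + norm (P x)"
      by (rule power2_le_imp_le) simp
    also have "\<dots> \<le> (?n / \<alpha> + (1 + c / \<alpha>) / \<beta> * ?n)
        + ((1 + c / \<alpha>) / \<beta> * ?n + c / \<beta>\<^sup>2 * (1 + c / \<alpha>) * ?n)"
      using saddle_point_estimate[OF A Rb pos(1,2) less_imp_le[OF pos(3)] norm_ge_zero
          norm_ge_zero A_bound infsup coercive f g]
      by (rule add_mono)
    \<comment> \<open>The two Brezzi estimates with \<open>f\<close> and \<open>g\<close> both equal
      to \<open>norm (L x)\<close> have coefficients adding up to \<open>K\<close> without its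
      operator part \<open>c + d\<close>.\<close>
    also have "\<dots> = (K - (c + d)) * ?n" by (simp add: K algebra_simps)
    also have "\<dots> \<le> K * ?n" using pos by (intro mult_right_mono) auto
    finally show ?thesis .
  qed
  \<comment> \<open>This is injectivity of the transposed operator. As \<open>A\<close> is not
    assumed symmetric, it does not follow from \<open>below\<close>; coercivity still applies
    because it only involves the diagonal values \<open>inner (A u) u\<close>.\<close>
  have nondeg: "y = 0" if y: "\<And>x. blinfun_apply (L x) y = 0" for y
  proof -
    have y0: "F x y = 0" for x using y by (simp add: LF)
    have ker: "inner (R p) (U y) = 0" for p
    proof -
      obtain x where "U x = 0" "P x = p" using split by blast
      then show ?thesis using y0[of x] by (simp add: form linear_0[OF A])
    qed
    have eq: "inner (A u) (U y) + inner (R (P y)) u = 0" for u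
    proof -
      obtain x where "U x = u" "P x = 0" using split by blast
      then show ?thesis using y0[of x] by (simp add: form linear_0[OF R])
    qed
    have "\<alpha> * (norm (U y))\<^sup>2 \<le> 0"
      using coercive[OF ker] eq[of "U y"] ker by simp
    then have Uy: "U y = 0" using pos by (simp add: mult_le_0_iff)
    \<comment> \<open>With \<open>U y = 0\<close>, testing \<open>eq\<close> with
      \<open>R (P y)\<close> itself leaves its squared norm.\<close>
    have "R (P y) = 0" using eq[of "R (P y)"] by (simp add: Uy)
    then have "\<beta> * norm (P y) \<le> 0" using infsup[of "P y"] by simp
    then have "P y = 0" using pos by (simp add: mult_le_0_iff)
    then show ?thesis using norm_split[of y] Uy by simp
  qed
  have "L = (\<lambda>x. Blinfun (F x))" by (simp add: L_def fun_eq_iff)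
  then show ?thesis
    using LF L K0 \<open>onorm L \<le> K\<close> bounded_below_operator_invertible[OF L K0 below nondeg]
    by simp
qed

section \<open>The Brezzi conditions of one subproblem in terms of representing vectors\<close>

text \<open>For a fixed multiplier \<open>z\<close>, the constraint form is a bounded functional of
  \<open>u\<close>, and \<open>S z\<close> is its Riesz vector. By Cauchy-Schwarz every quotient in
  the inf-sup condition is at most \<open>norm (S z)\<close>, which turns that condition into a
  lower bound for \<open>S\<close>.\<close>

lemma brezzi_constraint_operator:
  fixes B :: "'v::{real_inner,complete_space} \<Rightarrow> ('q::{real_inner,complete_space} \<Rightarrow>\<^sub>L real)"
    and T :: "'v \<Rightarrow> ('l::{real_inner,complete_space} \<Rightarrow>\<^sub>L real)"
  assumes brezzi: "brezzi_conditions A B T \<alpha> C \<beta> D" and B: "linear B" and T: "linear T"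
  obtains S where "linear S"
    and "\<And>u q l. inner (S (q, l)) u = blinfun_apply (B u) q + blinfun_apply (T u) l"
    and "\<And>z. norm (S z) \<le> D * norm z" and "\<And>z. \<beta> * norm z \<le> norm (S z)"
proof -
  define b where "b z u = blinfun_apply (B u) (fst z) + blinfun_apply (T u) (snd z)" for z u
  define S where "S z = riesz (Blinfun (b z))" for z
  have D: "0 < D"
    and b_le: "\<And>z u. b z u \<le> D * norm u * norm z"
    and Sup: "\<And>z. \<beta> * norm z \<le> Sup (insert 0 {b z u / norm u | u. u \<noteq> 0})"
    using brezzi unfolding brezzi_conditions_def b_def by (auto simp: norm_prod_def)
  have b_lin: "b z (u + v) = b z u + b z v" "b z (r *\<^sub>R u) = r * b z u" for z u v r
    by (simp_all add: b_def linear_add[OF B] linear_add[OF T] linear_scale[OF B] linear_scale[OF T]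
        blinfun.bilinear_simps algebra_simps)
  \<comment> \<open>The assumed bound is one-sided; applying it to \<open>- u\<close> as well bounds
    the absolute value.\<close>
  have "\<bar>b z u\<bar> \<le> D * norm u * norm z" for z u
    using b_le[of z u] b_le[of z "- u"] b_lin(2)[of z "-1" u] by (simp add: abs_le_iff)
  then have "bounded_linear (b z)" for z
    by (intro bounded_linear_intro[where K = "D * norm z"]) (simp_all add: b_lin mult_ac)
  then have Sb: "inner (S z) u = b z u" for z u
    by (simp add: S_def bounded_linear_Blinfun_apply)
  show ?thesis
  proof
    show "linear S"
    proof (rule linearI)
      fix x y :: "'q \<times> 'l" and r :: real
      show "S (x + y) = S x + S y"
        by (rule vector_eq_rdot[THEN iffD1])
          (simp add: inner_simps Sb b_def blinfun.bilinear_simps)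
      show "S (r *\<^sub>R x) = r *\<^sub>R S x"
        by (rule vector_eq_rdot[THEN iffD1])
          (simp add: inner_simps Sb b_def blinfun.bilinear_simps algebra_simps)
    qed
    show "inner (S (q, l)) u = blinfun_apply (B u) q + blinfun_apply (T u) l" for u q l
      by (simp add: Sb b_def)
    show "norm (S z) \<le> D * norm z" for z
      using b_le[of z] D by (intro norm_le_if_inner_le) (simp_all add: Sb mult_ac)
    show "\<beta> * norm z \<le> norm (S z)" for z
    \<comment> \<open>The inserted 0 keeps the set nonempty even if the space is trivial.\<close>
    proof (rule order_trans[OF Sup cSup_least])
      fix t assume "t \<in> insert 0 {b z u / norm u | u. u \<noteq> 0}"
      then show "t \<le> norm (S z)"
        using norm_cauchy_schwarz[of "S z"] by (auto simp: Sb divide_le_eq)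
    qed simp
  qed
qed

lemma norm_riesz_le_if_brezzi:
  assumes "brezzi_conditions A B T \<alpha> C \<beta> D"
  shows "norm (riesz (A u)) \<le> C * norm u"
  using assms unfolding brezzi_conditions_def by (intro norm_le_if_inner_le) auto

text \<open>The range condition gives \<open>k (inv k (j x)) = j x\<close>, and injectivity of
  \<open>k\<close> transfers linearity from \<open>j\<close>. This makes the inclusions of the
  intersection linear.\<close>

lemma linear_inclusion:
  assumes k: "linear k" "inj k" and j: "linear j" and "range j \<subseteq> range k"
  shows "linear (\<lambda>x. inv k (j x))"
proof -
  have kj: "k (inv k (j x)) = j x" for x
    using assms(4) by (intro f_inv_into_f) auto
  show ?thesis
    by (rule linearI; rule injD[OF k(2)])
      (simp_all add: kj linear_add[OF k(1)] linear_scale[OF k(1)] flip: linear_add[OF j] linear_scale[OF j])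
qed

section \<open>The coupled problem with the intersection as multiplier space\<close>

theorem theorem3p1:
  fixes A1 :: "'v1::{real_inner,complete_space} \<Rightarrow> ('v1 \<Rightarrow>\<^sub>L real)"
    and A2 :: "'v2::{real_inner,complete_space} \<Rightarrow> ('v2 \<Rightarrow>\<^sub>L real)"
    and B1 :: "'v1 \<Rightarrow> ('q1::{real_inner,complete_space} \<Rightarrow>\<^sub>L real)"
    and B2 :: "'v2 \<Rightarrow> ('q2::{real_inner,complete_space} \<Rightarrow>\<^sub>L real)"
    and T1 :: "'v1 \<Rightarrow> ('l1::{real_inner,complete_space} \<Rightarrow>\<^sub>L real)"
    and T2 :: "'v2 \<Rightarrow> ('l2::{real_inner,complete_space} \<Rightarrow>\<^sub>L real)"
    and j1 :: "'l1 \<Rightarrow> 'e::{real_vector,topological_ab_group_add,t2_space}"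
    and j2 :: "'l2 \<Rightarrow> 'e"
    and j :: "'l::{real_inner,complete_space} \<Rightarrow> 'e"
    and \<alpha>1 C1 \<beta>1 D1 \<alpha>2 C2 \<beta>2 D2 :: real
  assumes "hausdorff_tvs TYPE('e)"
    and "continuous_embedding j1" and "continuous_embedding j2"
    and "is_intersection j1 j2 j"
    and "linear A1" and "linear B1" and "linear T1"
    and "linear A2" and "linear B2" and "linear T2"
    and "brezzi_conditions A1 B1 T1 \<alpha>1 C1 \<beta>1 D1"
    and "brezzi_conditions A2 B2 T2 \<alpha>2 C2 \<beta>2 D2"
    and "strong_coercivity A1 B1 \<alpha>1"
    and "strong_coercivity A2 B2 \<alpha>2"
  defines "i1 \<equiv> \<lambda>x. inv j1 (j x)"
    and "i2 \<equiv> \<lambda>x. inv j2 (j x)"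
  defines "\<A> \<equiv> coupled_operator A1 A2 B1 B2 T1 T2 i1 i2"
    and "C \<equiv> coupled_bound \<alpha>1 C1 \<beta>1 D1 \<alpha>2 C2 \<beta>2 D2"
  shows "(\<forall>x y. blinfun_apply (\<A> x) y = coupled_form A1 A2 B1 B2 T1 T2 i1 i2 x y)
       \<and> bij \<A> \<and> 0 < C
       \<and> bounded_linear \<A> \<and> onorm \<A> \<le> C
       \<and> bounded_linear (inv \<A>) \<and> onorm (inv \<A>) \<le> C"
proof -
  have emb: "linear j1" "inj j1" "linear j2" "inj j2" "linear j"
    "range j \<subseteq> range j1" "range j \<subseteq> range j2"
    and norm_l: "\<And>x. norm x = sqrt ((norm (i1 x))\<^sup>2 + (norm (i2 x))\<^sup>2)"
    using assms(2-4) unfolding continuous_embedding_def is_intersection_def i1_def i2_def by auto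
  have i1: "linear i1" and i2: "linear i2"
    unfolding i1_def i2_def using emb by (auto intro: linear_inclusion)
  have pos: "0 < \<alpha>1" "0 < \<beta>1" "0 < C1" "0 < D1" "0 < \<alpha>2" "0 < \<beta>2" "0 < C2" "0 < D2"
    using assms(11,12) unfolding brezzi_conditions_def by auto
  obtain S1 where S1: "linear S1"
    "\<And>u q l. inner (S1 (q, l)) u = blinfun_apply (B1 u) q + blinfun_apply (T1 u) l"
    "\<And>z. norm (S1 z) \<le> D1 * norm z" "\<And>z. \<beta>1 * norm z \<le> norm (S1 z)"
    using brezzi_constraint_operator[OF assms(11,6,7)] by metis
  obtain S2 where S2: "linear S2"
    "\<And>u q l. inner (S2 (q, l)) u = blinfun_apply (B2 u) q + blinfun_apply (T2 u) l"
    "\<And>z. norm (S2 z) \<le> D2 * norm z" "\<And>z. \<beta>2 * norm z \<le> norm (S2 z)"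
    using brezzi_constraint_operator[OF assms(12,9,10)] by metis
  \<comment> \<open>The weaker of the two constants serves both subproblems.\<close>
  define \<alpha> c \<beta> d where "\<alpha> = min \<alpha>1 \<alpha>2" and "c = max C1 C2" and "\<beta> = min \<beta>1 \<beta>2"
    and "d = max D1 D2"
  note defs = \<alpha>_def c_def \<beta>_def d_def
  define A where "A = (\<lambda>(u1, u2). (riesz (A1 u1), riesz (A2 u2)))"
  \<comment> \<open>Only \<open>l\<close> couples the subproblems: it enters both components,
    through its two inclusions.\<close>
  define R where "R = (\<lambda>(q1, q2, l). (S1 (q1, i1 l), S2 (q2, i2 l)))"
  define U :: "'v1 \<times> 'v2 \<times> 'q1 \<times> 'q2 \<times> 'l \<Rightarrow> 'v1 \<times> 'v2" where "U = (\<lambda>(u1, u2, p). (u1, u2))"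
  define P :: "'v1 \<times> 'v2 \<times> 'q1 \<times> 'q2 \<times> 'l \<Rightarrow> 'q1 \<times> 'q2 \<times> 'l" where "P = (\<lambda>(u1, u2, p). p)"
  have rA: "linear (\<lambda>u. riesz (A1 u))" "linear (\<lambda>u. riesz (A2 u))"
    using linear_compose[OF assms(5) linear_riesz] linear_compose[OF assms(8) linear_riesz]
    by (simp_all add: o_def)
  have linA: "linear A"
    by (rule linearI) (auto simp: A_def linear_add[OF rA(1)] linear_add[OF rA(2)]
        linear_scale[OF rA(1)] linear_scale[OF rA(2)])
  have S_add: "S1 (a + a', b + b') = S1 (a, b) + S1 (a', b')"
    "S2 (e + e', f + f') = S2 (e, f) + S2 (e', f')" for a a' b b' e e' f f'
    using linear_add[OF S1(1), of "(a, b)" "(a', b')"] linear_add[OF S2(1), of "(e, f)" "(e', f')"]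
    by simp_all
  have S_scale: "S1 (r *\<^sub>R a, r *\<^sub>R b) = r *\<^sub>R S1 (a, b)"
    "S2 (r *\<^sub>R e, r *\<^sub>R f) = r *\<^sub>R S2 (e, f)" for r a b e f
    using linear_scale[OF S1(1), of r "(a, b)"] linear_scale[OF S2(1), of r "(e, f)"] by simp_all
  have linR: "linear R"
    by (rule linearI) (auto simp: R_def linear_add[OF i1] linear_add[OF i2]
        linear_scale[OF i1] linear_scale[OF i2] S_add S_scale)
  have linU: "linear U" and linP: "linear P"
    by (rule linearI; auto simp: U_def P_def)+
  \<comment> \<open>By the choice of the intersection norm, sending \<open>(q1, q2, l)\<close> to
    the pair of \<open>(q1, i1 l)\<close> and \<open>(q2, i2 l)\<close> is isometric. All constants
    thus carry over without loss.\<close>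
  have norm_multipliers: "(norm (q1, i1 l))\<^sup>2 + (norm (q2, i2 l))\<^sup>2 = (norm (q1, q2, l))\<^sup>2" for q1 q2 l
    by (simp add: power2_norm_Pair norm_l[of l])
  have A_bound: "norm (A u) \<le> c * norm u" for u
  proof (rule power2_le_imp_le)
    obtain u1 u2 where u: "u = (u1, u2)" by (rule prod.exhaust)
    have "norm (riesz (A1 u1)) \<le> c * norm u1"
      by (rule order_trans[OF norm_riesz_le_if_brezzi[OF assms(11)]])
        (auto simp: c_def intro: mult_right_mono)
    moreover have "norm (riesz (A2 u2)) \<le> c * norm u2"
      by (rule order_trans[OF norm_riesz_le_if_brezzi[OF assms(12)]])
        (auto simp: c_def intro: mult_right_mono)
    ultimately have "(norm (riesz (A1 u1)))\<^sup>2 + (norm (riesz (A2 u2)))\<^sup>2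
        \<le> (c * norm u1)\<^sup>2 + (c * norm u2)\<^sup>2"
      by (intro add_mono power_mono) simp_all
    also have "\<dots> = (c * norm u)\<^sup>2"
      by (simp add: u power_mult_distrib power2_norm_Pair algebra_simps)
    finally show "(norm (A u))\<^sup>2 \<le> (c * norm u)\<^sup>2"
      by (simp add: A_def u power2_norm_Pair)
  qed (use pos in \<open>auto simp: c_def\<close>)
  have R_bound: "norm (R z) \<le> d * norm z" for z
  proof (rule power2_le_imp_le)
    obtain q1 q2 l where z: "z = (q1, q2, l)" by (rule prod_cases3)
    have "norm (S1 (q1, i1 l)) \<le> d * norm (q1, i1 l)"
      by (rule order_trans[OF S1(3)]) (auto simp: d_def intro: mult_right_mono)
    moreover have "norm (S2 (q2, i2 l)) \<le> d * norm (q2, i2 l)"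
      by (rule order_trans[OF S2(3)]) (auto simp: d_def intro: mult_right_mono)
    ultimately have "(norm (S1 (q1, i1 l)))\<^sup>2 + (norm (S2 (q2, i2 l)))\<^sup>2
        \<le> (d * norm (q1, i1 l))\<^sup>2 + (d * norm (q2, i2 l))\<^sup>2"
      by (intro add_mono power_mono) simp_all
    also have "\<dots> = (d * norm z)\<^sup>2"
      unfolding z power_mult_distrib norm_multipliers[symmetric] by (simp add: algebra_simps)
    finally show "(norm (R z))\<^sup>2 \<le> (d * norm z)\<^sup>2"
      by (simp add: R_def z power2_norm_Pair[of "S1 _"])
  qed (use pos in \<open>auto simp: d_def\<close>)
  \<comment> \<open>The components of \<open>R z\<close> lie in different factors of the product, so
    their squared norms add and nothing cancels between the two subproblems.\<close>
  have infsup: "\<beta> * norm z \<le> norm (R z)" for z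
  proof (rule power2_le_imp_le)
    obtain q1 q2 l where z: "z = (q1, q2, l)" by (rule prod_cases3)
    have "\<beta> * norm (q1, i1 l) \<le> norm (S1 (q1, i1 l))"
      by (rule order_trans[OF _ S1(4)]) (auto simp: \<beta>_def intro: mult_right_mono)
    moreover have "\<beta> * norm (q2, i2 l) \<le> norm (S2 (q2, i2 l))"
      by (rule order_trans[OF _ S2(4)]) (auto simp: \<beta>_def intro: mult_right_mono)
    ultimately have "(\<beta> * norm (q1, i1 l))\<^sup>2 + (\<beta> * norm (q2, i2 l))\<^sup>2
        \<le> (norm (S1 (q1, i1 l)))\<^sup>2 + (norm (S2 (q2, i2 l)))\<^sup>2"
      using pos by (intro add_mono power_mono) (simp_all add: \<beta>_def)
    moreover have "(\<beta> * norm z)\<^sup>2 = (\<beta> * norm (q1, i1 l))\<^sup>2 + (\<beta> * norm (q2, i2 l))\<^sup>2"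
      unfolding z power_mult_distrib norm_multipliers[symmetric] by (simp add: algebra_simps)
    ultimately show "(\<beta> * norm z)\<^sup>2 \<le> (norm (R z))\<^sup>2"
      by (simp add: R_def z power2_norm_Pair[of "S1 _"])
  qed simp
  have coercive: "\<alpha> * (norm u)\<^sup>2 \<le> inner (A u) u" if ker: "\<And>z. inner (R z) u = 0" for u
  proof -
    obtain u1 u2 where u: "u = (u1, u2)" by (rule prod.exhaust)
    \<comment> \<open>Multipliers with \<open>l = 0\<close> remove the coupling. Those with
      \<open>l\<close> nonzero would only constrain the sum of the \<open>T1\<close> and
      \<open>T2\<close> terms, so strong coercivity is invoked.\<close>
    have "blinfun_apply (B1 u1) q = 0" for q
      using ker[of "(q, 0, 0)"]
      by (simp add: R_def u S1(2) S2(2) linear_0[OF i1] linear_0[OF i2])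
    then have "\<alpha>1 * (norm u1)\<^sup>2 \<le> blinfun_apply (A1 u1) u1"
      using assms(13) unfolding strong_coercivity_def by blast
    moreover have "blinfun_apply (B2 u2) q = 0" for q
      using ker[of "(0, q, 0)"]
      by (simp add: R_def u S1(2) S2(2) linear_0[OF i1] linear_0[OF i2])
    then have "\<alpha>2 * (norm u2)\<^sup>2 \<le> blinfun_apply (A2 u2) u2"
      using assms(14) unfolding strong_coercivity_def by blast
    moreover have "\<alpha> * (norm u1)\<^sup>2 \<le> \<alpha>1 * (norm u1)\<^sup>2" "\<alpha> * (norm u2)\<^sup>2 \<le> \<alpha>2 * (norm u2)\<^sup>2"
      by (auto simp: \<alpha>_def intro: mult_right_mono)
    ultimately show ?thesis by (simp add: A_def u power2_norm_Pair distrib_left)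
  qed
  show ?thesis
    unfolding \<A>_def coupled_operator_def
  proof (rule saddle_point_well_posed[where U = U and P = P and A = A and R = R
        and \<alpha> = \<alpha> and \<beta> = \<beta> and c = c and d = d])
    show "\<exists>x. U x = v \<and> P x = q" for v q
      by (rule exI[of _ "(fst v, snd v, q)"]) (simp add: U_def P_def)
    show "(norm x)\<^sup>2 = (norm (U x))\<^sup>2 + (norm (P x))\<^sup>2" for x
      by (cases x) (simp add: U_def P_def power2_norm_Pair)
    show "coupled_form A1 A2 B1 B2 T1 T2 i1 i2 x y
        = inner (A (U x) + R (P x)) (U y) + inner (R (P y)) (U x)" for x y
      by (cases x; cases y)
        (simp add: coupled_form_def A_def R_def U_def P_def inner_add_left S1(2) S2(2))
    show "C = c + d + 1 / \<alpha> + 2 / \<beta> * (1 + c / \<alpha>) + c / \<beta>\<^sup>2 * (1 + c / \<alpha>)"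
      by (simp add: C_def coupled_bound_def Let_def defs)
    show "0 < \<alpha>" "0 < \<beta>" "0 < c" "0 < d" using pos by (auto simp: defs)
  qed (fact linA linR linU linP A_bound R_bound infsup coercive)+
qed

end
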